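(* Consider a BNFP instance on a unit capacity directed graph $G=(V,E)$ (all $u_{ij}=1$) whose auxiliary graph $G^*$ admits an $s$–$t$ flow of value $\delta$, and let $D$ be a positive integer. Let $\bar x$ be the flow produced by Algorithm ABST with parameter $D$ (described in the context), and let $\bar c=\max\{c_{ij}:\bar x_{ij}>0\}$. Then $\bar c$ is a lower bound on the optimal objective value of the BNFP, and $\delta-v(\bar x)\le \frac{2|E|}{D}$.
   Context: BNFP: given a directed graph $G=(V,E)$ without multiple arcs, integer weights $c_{ij}$ and capacities $u_{ij}$ on arcs, and integers $b_i$ with $\sum_i b_i=0$, minimize $\max\{c_{ij}:x_{ij}>0\}$ subject to $\sum_{j:(i,j)\in E}x_{ij}-\sum_{j:(j,i)\in E}x_{ji}=b_i$ for all $i$ and $0\le x_{ij}\le u_{ij}$. Let $S=\{i:b_i>0\}$, $T=\{i:b_i<0\}$, $\delta=\sum_{i\in S}b_i$. The auxiliary graph $G^*=(V^*,E^* )$ has $V^*=V\cup\{s,t\}$, $E^*=E\cup\{(s,i):i\in S\}\cup\{(j,t):j\in T\}$, with capacity $b_i$ on $(s,i)$, $-b_j$ on $(j,t)$, weight $0$ on these new arcs. For real $\alpha$, $G^*(\alpha)$ is the spanning subgraph of $G^*$ with the arcs of weight at most $\alpha$. $v(x)$ is the value of an $s$–$t$ flow $x$. Shortest augmenting path algorithm (for max flow): maintains exact distance labels $d(i)$ = length (number of arcs) of a shortest path from $i$ to $t$ in the residual graph; from a current node (initially $s$) it advances along an admissible residual arc $(i,j)$ with $d(i)=d(j)+1$,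 augments along the path found when $t$ is reached and restarts at $s$, and when no admissible arc leaves the current node $i$ it relabels $d(i):=\min\{d(j)+1:(i,j)\text{ residual}\}$ and retreats to the predecessor; it terminates when $d(s)\ge |V^*|$. For an integer $D'$, the $D'$-shortest augmenting path algorithm is the same procedure except that every node $i$ with $d(i)\ge D'$ is discarded from further consideration (in particular it stops once $d(s)\ge D'$). Algorithm ABST (parameter $D$): let $c_{\sigma(1)}<\dots<c_{\sigma(\varphi)}$ be the distinct arc weights of $G$; set $l=1$, $u=\varphi$; while $u-l\ge1$: set $k=\lfloor (l+u)/2\rfloor$, run the $(D+2)$-shortest augmenting path algorithm on $G^*(c_{\sigma(k)})$ obtaining a flow $x^k$; if $\delta-v(x^k)\le |E_k|/D$, where $E_k$ is the arc set of $G^*(c_{\sigma(k)})$, set $u=k$, else set $l=k+1$. When $u=l$, output the flow $\bar x$ produced by the $(D+2)$-shortest augmenting path algorithm on $G^*(c_{\sigma(u)})$.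
   Formalization: The bound δ−v(x̄) ≤ 2|E|/D is proved only if |S|+|T| ≤ |E|+1 (true for connected G; it can fail otherwise), and the arcs at s and t are kept in G*(α) also for negative α, since with weight 0 the claim fails for negative weights. *)

theory Defs
  imports Complex_Main "HOL-Library.Extended_Real" "Graph_Theory.Graph_Theory"
begin

section \<open>Flows\<close>

definition net_out :: "'v pair_pre_digraph \<Rightarrow> ('v \<times> 'v \<Rightarrow> real) \<Rightarrow> 'v \<Rightarrow> real" where
  "net_out N x i =
     (\<Sum>j\<in>{j. (i, j) \<in> parcs N}. x (i, j)) - (\<Sum>j\<in>{j. (j, i) \<in> parcs N}. x (j, i))"

definition st_flow ::
  "'v pair_pre_digraph \<Rightarrow> ('v \<times> 'v \<Rightarrow> int) \<Rightarrow> 'v \<Rightarrow> 'v \<Rightarrow> ('v \<times> 'v \<Rightarrow> real) \<Rightarrow> bool" where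
  "st_flow N cap s t x \<longleftrightarrow>
     (\<forall>e\<in>parcs N. 0 \<le> x e \<and> x e \<le> of_int (cap e)) \<and>
     (\<forall>i\<in>pverts N - {s, t}. net_out N x i = 0)"

definition flow_value :: "'v pair_pre_digraph \<Rightarrow> 'v \<Rightarrow> ('v \<times> 'v \<Rightarrow> real) \<Rightarrow> real" where
  "flow_value N s x = net_out N x s"


section \<open>Bottleneck network flow problem\<close>

locale bnfp_instance = pair_fin_digraph G for G :: "'a pair_pre_digraph" +
  fixes b :: "'a \<Rightarrow> int"
  assumes balanced: "(\<Sum>i\<in>pverts G. b i) = 0"

definition bnfp_feasible ::
  "'a pair_pre_digraph \<Rightarrow> ('a \<times> 'a \<Rightarrow> int) \<Rightarrow> ('a \<Rightarrow> int) \<Rightarrow> ('a \<times> 'a \<Rightarrow> real) \<Rightarrow> bool" where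
  "bnfp_feasible G u b x \<longleftrightarrow>
     (\<forall>i\<in>pverts G. net_out G x i = of_int (b i)) \<and>
     (\<forall>e\<in>parcs G. 0 \<le> x e \<and> x e \<le> of_int (u e))"

text \<open>The objective \<open>max {c e | x e > 0}\<close>. It is taken in the extended reals, so that it has the
  value \<open>-\<infinity>\<close> if no arc carries flow.\<close>

definition bottleneck ::
  "'a pair_pre_digraph \<Rightarrow> ('a \<times> 'a \<Rightarrow> int) \<Rightarrow> ('a \<times> 'a \<Rightarrow> real) \<Rightarrow> ereal" where
  "bottleneck G c x = (SUP e\<in>{e \<in> parcs G. x e > 0}. ereal (of_int (c e)))"

text \<open>The infimum is a minimum whenever the problem is feasible: the objective takes finitely
  many values.\<close>

definition bnfp_opt ::
  "'a pair_pre_digraph \<Rightarrow> ('a \<times> 'a \<Rightarrow> int) \<Rightarrow> ('a \<times> 'a \<Rightarrow> int) \<Rightarrow> ('a \<Rightarrow> int) \<Rightarrow> ereal" where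
  "bnfp_opt G c u b = (INF x\<in>{x. bnfp_feasible G u b x}. bottleneck G c x)"

definition supply_nodes :: "'a pair_pre_digraph \<Rightarrow> ('a \<Rightarrow> int) \<Rightarrow> 'a set" where
  "supply_nodes G b = {i \<in> pverts G. b i > 0}"

definition demand_nodes :: "'a pair_pre_digraph \<Rightarrow> ('a \<Rightarrow> int) \<Rightarrow> 'a set" where
  "demand_nodes G b = {i \<in> pverts G. b i < 0}"

definition total_supply :: "'a pair_pre_digraph \<Rightarrow> ('a \<Rightarrow> int) \<Rightarrow> int" where
  "total_supply G b = (\<Sum>i\<in>supply_nodes G b. b i)"


section \<open>Auxiliary graph\<close>

datatype 'a aux_vertex = Src | Snk | Orig 'a

definition orig_flow :: "('a aux_vertex \<times> 'a aux_vertex \<Rightarrow> real) \<Rightarrow> 'a \<times> 'a \<Rightarrow> real" where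
  "orig_flow x = (\<lambda>(i, j). x (Orig i, Orig j))"

definition terminal_arcs ::
  "'a pair_pre_digraph \<Rightarrow> ('a \<Rightarrow> int) \<Rightarrow> ('a aux_vertex \<times> 'a aux_vertex) set" where
  "terminal_arcs G b =
     (\<lambda>i. (Src, Orig i)) ` supply_nodes G b \<union> (\<lambda>j. (Orig j, Snk)) ` demand_nodes G b"

definition aux_graph ::
  "'a pair_pre_digraph \<Rightarrow> ('a \<Rightarrow> int) \<Rightarrow> 'a aux_vertex pair_pre_digraph" where
  "aux_graph G b =
     \<lparr> pverts = {Src, Snk} \<union> Orig ` pverts G,
       parcs = {(Orig i, Orig j) | i j. (i, j) \<in> parcs G} \<union> terminal_arcs G b \<rparr>"

text \<open>Only the arcs leaving the source, the arcs entering the sink and the original arcs occur in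
  the auxiliary graph; the last equation is a dummy.\<close>

fun aux_cap ::
  "('a \<times> 'a \<Rightarrow> int) \<Rightarrow> ('a \<Rightarrow> int) \<Rightarrow> 'a aux_vertex \<times> 'a aux_vertex \<Rightarrow> int" where
  "aux_cap u b (Orig i, Orig j) = u (i, j)"
| "aux_cap u b (Src, Orig i) = b i"
| "aux_cap u b (Orig j, Snk) = - b j"
| "aux_cap u b _ = 0"

text \<open>The spanning subgraph of the arcs of weight at most \<open>\<alpha>\<close>. The arcs at the source and the sink
  carry the neutral weight of the bottleneck objective and belong to every such subgraph. For
  \<open>\<alpha> \<ge> 0\<close> this is the same as giving them the weight \<open>0\<close>; for \<open>\<alpha> < 0\<close> the weight \<open>0\<close> would
  disconnect the source and the sink.\<close>

definition aux_subgraph ::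
  "'a pair_pre_digraph \<Rightarrow> ('a \<times> 'a \<Rightarrow> int) \<Rightarrow> ('a \<Rightarrow> int) \<Rightarrow> real \<Rightarrow> 'a aux_vertex pair_pre_digraph" where
  "aux_subgraph G c b \<alpha> =
     \<lparr> pverts = pverts (aux_graph G b),
       parcs = {(Orig i, Orig j) | i j. (i, j) \<in> parcs G \<and> of_int (c (i, j)) \<le> \<alpha>}
               \<union> terminal_arcs G b \<rparr>"


section \<open>Residual graph and shortest augmenting paths\<close>

text \<open>The residual arc \<open>(e, True)\<close> is \<open>e\<close> itself, \<open>(e, False)\<close> is the reversal of \<open>e\<close>. The label
  keeps the two apart when the network contains a pair of antiparallel arcs.\<close>

type_synonym 'v res_arc = "('v \<times> 'v) \<times> bool"

fun res_tail :: "'v res_arc \<Rightarrow> 'v" where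
  "res_tail (e, fwd) = (if fwd then fst e else snd e)"

fun res_head :: "'v res_arc \<Rightarrow> 'v" where
  "res_head (e, fwd) = (if fwd then snd e else fst e)"

fun res_cap :: "('v \<times> 'v \<Rightarrow> int) \<Rightarrow> ('v \<times> 'v \<Rightarrow> real) \<Rightarrow> 'v res_arc \<Rightarrow> real" where
  "res_cap cap x (e, fwd) = (if fwd then of_int (cap e) - x e else x e)"

definition residual ::
  "'v pair_pre_digraph \<Rightarrow> ('v \<times> 'v \<Rightarrow> int) \<Rightarrow> ('v \<times> 'v \<Rightarrow> real) \<Rightarrow> ('v, 'v res_arc) pre_digraph" where
  "residual N cap x =
     \<lparr> verts = pverts N,
       arcs = {a. fst a \<in> parcs N \<and> res_cap cap x a > 0},
       tail = res_tail, head = res_head \<rparr>"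

text \<open>The number of arcs of a shortest path, \<open>\<infinity>\<close> if there is no path.\<close>

definition arc_dist :: "('v, 'e) pre_digraph \<Rightarrow> 'v \<Rightarrow> 'v \<Rightarrow> enat" where
  "arc_dist R i t = (INF p\<in>{p. pre_digraph.apath R i p t}. enat (length p))"

definition augment ::
  "('v \<times> 'v \<Rightarrow> int) \<Rightarrow> 'v res_arc list \<Rightarrow> ('v \<times> 'v \<Rightarrow> real) \<Rightarrow> ('v \<times> 'v \<Rightarrow> real)" where
  "augment cap p x =
     (let \<theta> = Min (res_cap cap x ` set p)
      in (\<lambda>e. x e + (if (e, True) \<in> set p then \<theta> else 0) - (if (e, False) \<in> set p then \<theta> else 0)))"

text \<open>A state consists of the current flow, the distance labels and the list of residual arcs of
  the partial path from the source to the current node.\<close>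

type_synonym 'v sap_state = "('v \<times> 'v \<Rightarrow> real) \<times> ('v \<Rightarrow> enat) \<times> 'v res_arc list"

definition cur_node :: "'v \<Rightarrow> 'v res_arc list \<Rightarrow> 'v" where
  "cur_node s p = (if p = [] then s else res_head (last p))"

text \<open>Both ends of an admissible arc must not have been discarded. (This also excludes
  \<open>\<infinity> = \<infinity> + 1\<close>.)\<close>

definition admissible ::
  "'v pair_pre_digraph \<Rightarrow> ('v \<times> 'v \<Rightarrow> int) \<Rightarrow> nat \<Rightarrow> ('v \<times> 'v \<Rightarrow> real) \<Rightarrow> ('v \<Rightarrow> enat)
     \<Rightarrow> 'v res_arc \<Rightarrow> bool" where
  "admissible N cap D' x d a \<longleftrightarrow>
     a \<in> arcs (residual N cap x) \<and>
     d (res_tail a) < enat D' \<and> d (res_head a) < enat D' \<and>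
     d (res_tail a) = d (res_head a) + 1"

definition sap_init ::
  "'v pair_pre_digraph \<Rightarrow> ('v \<times> 'v \<Rightarrow> int) \<Rightarrow> 'v \<Rightarrow> 'v sap_state" where
  "sap_init N cap t = ((\<lambda>_. 0), (\<lambda>i. arc_dist (residual N cap (\<lambda>_. 0)) i t), [])"

text \<open>The source label reaches \<open>|V|\<close> (the stopping rule of the shortest augmenting path algorithm)
  or \<open>D'\<close> (the source is discarded).\<close>

definition sap_stopped :: "'v pair_pre_digraph \<Rightarrow> 'v \<Rightarrow> nat \<Rightarrow> ('v \<Rightarrow> enat) \<Rightarrow> bool" where
  "sap_stopped N s D' d \<longleftrightarrow> d s \<ge> enat (card (pverts N)) \<or> d s \<ge> enat D'"

text \<open>One step of the \<open>D'\<close>-shortest augmenting path algorithm. The choice among several admissible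
  arcs is left open. In the rule \<open>relabel\<close> the infimum over the empty set is \<open>\<infinity>\<close>, and for the path
  \<open>[]\<close> the source remains the current node.\<close>

inductive sap_step ::
  "'v pair_pre_digraph \<Rightarrow> ('v \<times> 'v \<Rightarrow> int) \<Rightarrow> 'v \<Rightarrow> 'v \<Rightarrow> nat \<Rightarrow> 'v sap_state \<Rightarrow> 'v sap_state \<Rightarrow> bool"
  for N cap s t D' where
  advance:
    "\<not> sap_stopped N s D' d \<Longrightarrow> cur_node s p \<noteq> t \<Longrightarrow>
     admissible N cap D' x d a \<Longrightarrow> res_tail a = cur_node s p \<Longrightarrow>
     sap_step N cap s t D' (x, d, p) (x, d, p @ [a])"
| augment:
    "\<not> sap_stopped N s D' d \<Longrightarrow> cur_node s p = t \<Longrightarrow>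
     sap_step N cap s t D' (x, d, p) (augment cap p x, d, [])"
| relabel:
    "\<not> sap_stopped N s D' d \<Longrightarrow> cur_node s p = i \<Longrightarrow> i \<noteq> t \<Longrightarrow>
     \<not> (\<exists>a. admissible N cap D' x d a \<and> res_tail a = i) \<Longrightarrow>
     sap_step N cap s t D' (x, d, p)
       (x, d(i := (INF a\<in>{a \<in> arcs (residual N cap x). res_tail a = i}. d (res_head a) + 1)),
        butlast p)"

definition sap_output ::
  "'v pair_pre_digraph \<Rightarrow> ('v \<times> 'v \<Rightarrow> int) \<Rightarrow> 'v \<Rightarrow> 'v \<Rightarrow> nat \<Rightarrow> ('v \<times> 'v \<Rightarrow> real) \<Rightarrow> bool" where
  "sap_output N cap s t D' x \<longleftrightarrow>
     (\<exists>d p. (sap_step N cap s t D')\<^sup>*\<^sup>* (sap_init N cap t) (x, d, p) \<and> sap_stopped N s D' d)"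


section \<open>Algorithm ABST\<close>

function bisect :: "(nat \<Rightarrow> bool) \<Rightarrow> nat \<Rightarrow> nat \<Rightarrow> nat" where
  "bisect P l u =
     (if l < u
      then let k = (l + u) div 2 in if P k then bisect P l k else bisect P (k + 1) u
      else u)"
  by pat_completeness auto
termination by (relation "measure (\<lambda>(_, l, u). u - l)") auto

declare bisect.simps [simp del]

text \<open>The \<open>k\<close>-th smallest arc weight, counted from 1.\<close>

definition nth_weight :: "'a pair_pre_digraph \<Rightarrow> ('a \<times> 'a \<Rightarrow> int) \<Rightarrow> nat \<Rightarrow> int" where
  "nth_weight G c k = sorted_list_of_set (c ` parcs G) ! (k - 1)"

definition abst_test ::
  "'a pair_pre_digraph \<Rightarrow> ('a \<times> 'a \<Rightarrow> int) \<Rightarrow> ('a \<Rightarrow> int) \<Rightarrow> nat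
     \<Rightarrow> (real \<Rightarrow> 'a aux_vertex \<times> 'a aux_vertex \<Rightarrow> real) \<Rightarrow> nat \<Rightarrow> bool" where
  "abst_test G c b D X k \<longleftrightarrow>
     (let \<alpha> = of_int (nth_weight G c k); H = aux_subgraph G c b \<alpha>
      in of_int (total_supply G b) - flow_value H Src (X \<alpha>) \<le> real (card (parcs H)) / real D)"

text \<open>\<open>X \<alpha>\<close> is the flow that the \<open>(D + 2)\<close>-shortest augmenting path algorithm returns on the
  subgraph for \<open>\<alpha>\<close>. The ties are broken arbitrarily, but in the same way each time the procedure is
  applied to the same graph, so the final call reproduces the flow that passed the test.\<close>

definition abst_output ::
  "'a pair_pre_digraph \<Rightarrow> ('a \<times> 'a \<Rightarrow> int) \<Rightarrow> ('a \<times> 'a \<Rightarrow> int) \<Rightarrow> ('a \<Rightarrow> int) \<Rightarrow> nat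
     \<Rightarrow> ('a aux_vertex \<times> 'a aux_vertex \<Rightarrow> real) \<Rightarrow> bool" where
  "abst_output G c u b D xbar \<longleftrightarrow>
     (\<exists>X. (\<forall>\<alpha>. sap_output (aux_subgraph G c b \<alpha>) (aux_cap u b) Src Snk (D + 2) (X \<alpha>)) \<and>
          xbar = X (of_int (nth_weight G c
                     (bisect (abst_test G c b D X) 1 (card (c ` parcs G))))))"

end

theory Submission
  imports Defs
begin

text \<open>The distance labels of the shortest augmenting path algorithm never exceed the distances to
  the sink, so when the algorithm stops with source label at least \<open>D + 2\<close>, the sets of nodes with
  label above \<open>1, \<dots>, D\<close> are \<open>D\<close> cuts no two of which are crossed by the same
  residual arc, and which avoid the arcs at the source and the sink. For unit capacities their
  residual capacities add up to at most the number \<open>m\<close> of original arcs, so the flow is within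
  \<open>m / D\<close> of a maximum one. (If instead it stops because the source label is at least the
  number of nodes, some label is missing and gives a cut of residual capacity \<open>0\<close>.) Hence a failed
  test of the bisection certifies that no feasible solution uses only the arcs considered.

  A passed test only yields the bound \<open>|E\<^sub>k| / D\<close>, where \<open>E\<^sub>k\<close> contains the terminal arcs,
  of which there may be \<open>|E| + 1\<close>. The additional one is compensated by a missing original arc if
  \<open>E\<^sub>k\<close> omits one; otherwise the bound \<open>m / D\<close> applies directly.\<close>

section \<open>Cuts\<close>

text \<open>Coefficient of an arc in the net outflow of \<open>A\<close>. As a difference of
  indicators it is additive over the nodes of \<open>A\<close>, and arcs inside \<open>A\<close>
  cancel.\<close>

definition incidence :: "'v set \<Rightarrow> 'v \<times> 'v \<Rightarrow> real" where
  "incidence A e = of_bool (fst e \<in> A) - of_bool (snd e \<in> A)"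

text \<open>Residual capacity of \<open>e\<close> or of its reversal, whichever leaves
  \<open>A\<close>; indexing by arcs of \<open>N\<close> allows a termwise comparison with
  \<open>incidence\<close>.\<close>

definition cut_residual ::
  "'v pair_pre_digraph \<Rightarrow> ('v \<times> 'v \<Rightarrow> int) \<Rightarrow> ('v \<times> 'v \<Rightarrow> real) \<Rightarrow> 'v set \<Rightarrow> 'v \<times> 'v \<Rightarrow> real" where
  "cut_residual N cap x A e =
     (if fst e \<in> A \<and> snd e \<notin> A then of_int (cap e) - x e
      else if fst e \<notin> A \<and> snd e \<in> A then x e else 0)"

lemma net_out_incidence:
  assumes "finite (parcs N)"
  shows "net_out N x i = (\<Sum>e\<in>parcs N. x e * incidence {i} e)"
proof -
  have 1: "(\<Sum>j\<in>{j. (i, j) \<in> parcs N}. x (i, j)) = (\<Sum>e\<in>{e \<in> parcs N. fst e = i}. x e)"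
    by (rule sum.reindex_bij_witness[where i = snd and j = "\<lambda>j. (i, j)"]) auto
  have 2: "(\<Sum>j\<in>{j. (j, i) \<in> parcs N}. x (j, i)) = (\<Sum>e\<in>{e \<in> parcs N. snd e = i}. x e)"
    by (rule sum.reindex_bij_witness[where i = fst and j = "\<lambda>j. (j, i)"]) auto
  show ?thesis
    unfolding net_out_def 1 2 sum.inter_filter[OF assms] sum_subtractf[symmetric]
    by (intro sum.cong) (auto simp: incidence_def)
qed

lemma incidence_sum:
  assumes "finite A"
  shows "(\<Sum>i\<in>A. incidence {i} e) = incidence A e"
  using assms by (simp add: incidence_def sum_subtractf of_bool_def sum.delta)

locale flow_network = pair_fin_digraph N for N :: "'v pair_pre_digraph" +
  fixes cap :: "'v \<times> 'v \<Rightarrow> int" and s t :: 'v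
  assumes source_in_verts: "s \<in> pverts N"
    and sink_in_verts: "t \<in> pverts N"
    and source_neq_sink: "s \<noteq> t"
    and cap_nonneg: "e \<in> parcs N \<Longrightarrow> 0 \<le> cap e"
begin

text \<open>By conservation, summing \<open>net_out\<close> over \<open>A\<close> leaves only the
  term of \<open>s\<close>; exchanging the sums gives a sum over arcs.\<close>

lemma flow_value_cut:
  assumes "st_flow N cap s t x" "A \<subseteq> pverts N" "s \<in> A" "t \<notin> A"
  shows "flow_value N s x = (\<Sum>e\<in>parcs N. x e * incidence A e)"
proof -
  have fin: "finite A"
    using assms(2) pair_finite_verts by (rule finite_subset)
  have "(\<Sum>i\<in>A. net_out N x i) = net_out N x s + (\<Sum>i\<in>A - {s}. net_out N x i)"
    using fin assms(3) by (rule sum.remove)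
  also have "(\<Sum>i\<in>A - {s}. net_out N x i) = 0"
    using assms by (intro sum.neutral) (auto simp: st_flow_def)
  finally have "flow_value N s x = (\<Sum>i\<in>A. net_out N x i)"
    by (simp add: flow_value_def)
  also have "\<dots> = (\<Sum>i\<in>A. \<Sum>e\<in>parcs N. x e * incidence {i} e)"
    by (simp add: net_out_incidence pair_finite_arcs)
  also have "\<dots> = (\<Sum>e\<in>parcs N. \<Sum>i\<in>A. x e * incidence {i} e)"
    by (rule sum.swap)
  also have "\<dots> = (\<Sum>e\<in>parcs N. x e * incidence A e)"
    by (simp add: sum_distrib_left[symmetric] incidence_sum[OF fin])
  finally show ?thesis .
qed

text \<open>Weak duality relative to \<open>x\<close>: the difference of the flows crosses the cut,
  and each arc adds at most its residual capacity.\<close>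

lemma flow_value_gap_le_cut:
  assumes "st_flow N cap s t x" "st_flow N cap s t y" "A \<subseteq> pverts N" "s \<in> A" "t \<notin> A"
  shows "flow_value N s y - flow_value N s x \<le> (\<Sum>e\<in>parcs N. cut_residual N cap x A e)"
proof -
  have "flow_value N s y - flow_value N s x = (\<Sum>e\<in>parcs N. (y e - x e) * incidence A e)"
    using assms by (simp add: flow_value_cut[of _ A] sum_subtractf left_diff_distrib)
  also have "\<dots> \<le> (\<Sum>e\<in>parcs N. cut_residual N cap x A e)"
    using assms(1,2) by (intro sum_mono) (auto simp: st_flow_def incidence_def cut_residual_def)
  finally show ?thesis .
qed

end


section \<open>Distance labels\<close>

text \<open>Weaker than exactness: along residual paths such labels bound the distance to
  \<open>t\<close> from below. This is the property carried through augmenting and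
  relabelling.\<close>

definition valid_labels ::
  "'v pair_pre_digraph \<Rightarrow> ('v \<times> 'v \<Rightarrow> int) \<Rightarrow> 'v \<Rightarrow> ('v \<times> 'v \<Rightarrow> real) \<Rightarrow> ('v \<Rightarrow> enat) \<Rightarrow> bool" where
  "valid_labels N cap t x d \<longleftrightarrow>
     d t = 0 \<and> (\<forall>a\<in>arcs (residual N cap x). d (res_tail a) \<le> d (res_head a) + 1)"

lemma arcs_residual: "a \<in> arcs (residual N cap x) \<longleftrightarrow> fst a \<in> parcs N \<and> res_cap cap x a > 0"
  by (simp add: residual_def)

lemma residual_simps [simp]:
  "verts (residual N cap x) = pverts N"
  "tail (residual N cap x) = res_tail"
  "head (residual N cap x) = res_head"
  by (simp_all add: residual_def)

lemma (in wf_digraph) arc_dist_le_awalk: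
  assumes "awalk i p t"
  shows "arc_dist G i t \<le> enat (length p)"
proof -
  let ?q = "awalk_to_apath p"
  have q: "apath i ?q t"
    using assms by (rule apath_awalk_to_apath)
  then have "distinct (awalk_verts i ?q)"
    by (simp add: apath_def)
  \<comment> \<open>The shortening is controlled as an inclusion of arc sets; distinctness turns it
    into an inequality of lengths.\<close>
  then have "distinct ?q"
    by (auto simp: awalk_verts_conv distinct_map split: if_splits)
  then have "length ?q = card (set ?q)"
    by (simp add: distinct_card)
  also have "\<dots> \<le> card (set p)"
    using awalk_to_apath_subset[OF assms] by (intro card_mono) auto
  also have "\<dots> \<le> length p"
    by (rule card_length)
  finally have "enat (length ?q) \<le> enat (length p)"
    by simp
  moreover have "arc_dist G i t \<le> enat (length ?q)"
    unfolding arc_dist_def using q by (intro INF_lower) simp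
  ultimately show ?thesis
    by (rule order_trans[rotated])
qed

text \<open>Prepending \<open>a\<close> to a shortest path from its head may repeat a node; hence
  the detour through walks.\<close>

lemma (in wf_digraph) arc_dist_triangle:
  assumes "a \<in> arcs G"
  shows "arc_dist G (tail G a) t \<le> arc_dist G (head G a) t + 1"
proof (cases "{p. apath (head G a) p t} = {}")
  case True
  then show ?thesis
    by (simp add: arc_dist_def top_enat_def)
next
  case False
  then obtain p where p: "apath (head G a) p t" "arc_dist G (head G a) t = enat (length p)"
    using wellorder_InfI[of _ "(\<lambda>p. enat (length p)) ` {p. apath (head G a) p t}"]
    unfolding arc_dist_def by blast
  then have "awalk (tail G a) (a # p) t"
    using assms by (simp add: awalk_Cons_iff apath_def)
  from arc_dist_le_awalk[OF this] show ?thesis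
    using p by (simp add: one_enat_def)
qed

context flow_network
begin

lemma wf_digraph_residual: "wf_digraph (residual N cap x)"
proof
  fix a
  assume "a \<in> arcs (residual N cap x)"
  then show "tail (residual N cap x) a \<in> verts (residual N cap x)"
    "head (residual N cap x) a \<in> verts (residual N cap x)"
    using arc_fst_in_verts arc_snd_in_verts
    by (cases a; cases "snd a"; auto simp: arcs_residual)+
qed

lemma valid_labels_init: "valid_labels N cap t x (\<lambda>i. arc_dist (residual N cap x) i t)"
proof -
  interpret R: wf_digraph "residual N cap x"
    by (rule wf_digraph_residual)
  have "arc_dist (residual N cap x) t t = 0"
    using R.arc_dist_le_awalk[of t "[]" t]
    by (simp add: R.awalk_Nil_iff sink_in_verts zero_enat_def[symmetric])
  then show ?thesis
    using R.arc_dist_triangle by (simp add: valid_labels_def)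
qed

text \<open>A residual arc lowers the label by at most 1, so one that leaves the set of labels above
  \<open>k\<close> must step from \<open>k + 1\<close> to \<open>k\<close>.\<close>

lemma valid_labels_cut_residual:
  assumes "valid_labels N cap t x d" "st_flow N cap s t x" "e \<in> parcs N"
    and "cut_residual N cap x {i \<in> pverts N. enat k < d i} e \<noteq> 0"
  shows "(d (fst e) = enat (Suc k) \<and> d (snd e) = enat k) \<or>
         (d (snd e) = enat (Suc k) \<and> d (fst e) = enat k)"
proof -
  let ?A = "{i \<in> pverts N. enat k < d i}"
  have le: "d (res_tail a) \<le> d (res_head a) + 1" if "a \<in> arcs (residual N cap x)" for a
    using assms(1) that by (auto simp: valid_labels_def)
  have lev: "m = enat (Suc k) \<and> n = enat k" if "m \<le> n + 1" "enat k < m" "n \<le> enat k" for m n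
    using that by (cases m; cases n) (auto simp: one_enat_def)
  have v: "fst e \<in> pverts N" "snd e \<in> pverts N"
    using assms(3) arc_fst_in_verts arc_snd_in_verts by auto
  consider "fst e \<in> ?A" "snd e \<notin> ?A" "of_int (cap e) - x e > 0"
    | "snd e \<in> ?A" "fst e \<notin> ?A" "x e > 0"
    using assms(2-4) by (fastforce simp: cut_residual_def st_flow_def split: if_splits)
  then show ?thesis
  proof cases
    case 1
    then show ?thesis
      using le[of "(e, True)"] assms(3) v lev by (auto simp: arcs_residual not_less)
  next
    case 2
    then show ?thesis
      using le[of "(e, False)"] assms(3) v lev by (auto simp: arcs_residual not_less)
  qed
qed

text \<open>Pigeonhole: the nodes other than \<open>s\<close> cannot take all labels below the
  number of nodes. No residual arc jumps over a missing label, so it gives a cut of residual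
  capacity 0.\<close>

lemma source_label_card_imp_max_flow:
  assumes "valid_labels N cap t x d" "st_flow N cap s t x" "st_flow N cap s t y"
    and "enat (card (pverts N)) \<le> d s"
  shows "flow_value N s y \<le> flow_value N s x"
proof -
  let ?n = "card (pverts N)"
  have "\<not> enat ` {..<?n} \<subseteq> d ` (pverts N - {s})"
  proof
    assume "enat ` {..<?n} \<subseteq> d ` (pverts N - {s})"
    then have "card (enat ` {..<?n}) \<le> card (d ` (pverts N - {s}))"
      using pair_finite_verts by (intro card_mono) auto
    also have "\<dots> \<le> card (pverts N - {s})"
      using pair_finite_verts by (intro card_image_le) auto
    also have "\<dots> < ?n"
      using pair_finite_verts source_in_verts by (intro psubset_card_mono) auto
    finally show False
      by (simp add: card_image inj_on_def)
  qed
  then obtain k where k: "k < ?n" "enat k \<notin> d ` (pverts N - {s})"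
    by blast
  let ?A = "{i \<in> pverts N. enat k < d i}"
  have "enat k < d s"
    using k(1) assms(4) by (metis enat_ord_simps(2) less_le_trans)
  then have lev: "d i \<noteq> enat k" if "i \<in> pverts N" for i
    using k(2) that \<open>enat k < d s\<close> by (metis Diff_iff image_eqI less_irrefl singletonD)
  have "flow_value N s y - flow_value N s x \<le> (\<Sum>e\<in>parcs N. cut_residual N cap x ?A e)"
    using assms \<open>enat k < d s\<close> source_in_verts
    by (intro flow_value_gap_le_cut) (auto simp: valid_labels_def)
  also have "\<dots> = 0"
    using valid_labels_cut_residual[OF assms(1,2)] lev arc_fst_in_verts arc_snd_in_verts
    by (intro sum.neutral) blast
  finally show ?thesis
    by simp
qed

text \<open>An arc crosses at most one of the cuts at the levels \<open>1, \<dots>, D\<close>, and none of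
  them if it is at the source or the sink; so one of these cuts has small residual capacity.\<close>

lemma source_label_gap:
  assumes "valid_labels N cap t x d" "st_flow N cap s t x" "st_flow N cap s t y"
    and "enat (D + 2) \<le> d s"
    and unit: "\<And>e. e \<in> parcs N \<Longrightarrow> fst e \<noteq> s \<Longrightarrow> snd e \<noteq> t \<Longrightarrow> cap e \<le> 1"
  shows "real D * (flow_value N s y - flow_value N s x)
           \<le> real (card {e \<in> parcs N. fst e \<noteq> s \<and> snd e \<noteq> t})"
proof -
  define A where "A k = {i \<in> pverts N. enat k < d i}" for k
  have dt: "d t = 0"
    using assms(1) by (simp add: valid_labels_def)
  have dsk: "enat k < d s" if "k \<le> Suc D" for k
  proof -
    have "enat k < enat (D + 2)"
      using that by simp
    also note assms(4)
    finally show ?thesis .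
  qed
  \<comment> \<open>An arc is charged only to the cut at the smaller label of its ends, and there at
    most 1.\<close>
  have cross: "cut_residual N cap x (A k) e \<le>
        (if fst e \<noteq> s \<and> snd e \<noteq> t \<and> enat k = min (d (fst e)) (d (snd e)) then 1 else 0)"
    if e: "e \<in> parcs N" and k: "k \<in> {1..D}" for e k
  proof (cases "cut_residual N cap x (A k) e = 0")
    case False
    have lev: "(d (fst e) = enat (Suc k) \<and> d (snd e) = enat k) \<or>
         (d (snd e) = enat (Suc k) \<and> d (fst e) = enat k)"
      using valid_labels_cut_residual[OF assms(1,2) e] False by (simp add: A_def)
    \<comment> \<open>The levels \<open>k\<close> and \<open>k + 1\<close> are at most
      \<open>D + 1\<close>, hence below \<open>d s\<close>: this is where the 2 in
      \<open>D + 2\<close> is used. Next, \<open>k \<ge> 1\<close> excludes \<open>t\<close>, whose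
      label is 0.\<close>
    have "fst e \<noteq> s"
      using lev dsk[of k] dsk[of "Suc k"] k by auto
    moreover have "snd e \<noteq> t"
      using lev dt k by (auto simp: zero_enat_def)
    moreover have "cut_residual N cap x (A k) e \<le> 1"
      using assms(2) unit[OF e] e \<open>fst e \<noteq> s\<close> \<open>snd e \<noteq> t\<close>
      by (fastforce simp: cut_residual_def st_flow_def)
    ultimately show ?thesis
      using lev by auto
  qed auto
  have "real D * (flow_value N s y - flow_value N s x)
          = (\<Sum>k\<in>{1..D}. flow_value N s y - flow_value N s x)"
    by simp
  also have "\<dots> \<le> (\<Sum>k\<in>{1..D}. \<Sum>e\<in>parcs N. cut_residual N cap x (A k) e)"
  proof (rule sum_mono)
    fix k
    assume "k \<in> {1..D}"
    then show "flow_value N s y - flow_value N s x \<le> (\<Sum>e\<in>parcs N. cut_residual N cap x (A k) e)"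
      using dsk[of k] source_in_verts dt assms(2,3)
      by (intro flow_value_gap_le_cut) (auto simp: A_def)
  qed
  also have "\<dots> \<le> (\<Sum>k\<in>{1..D}. \<Sum>e\<in>parcs N.
      if fst e \<noteq> s \<and> snd e \<noteq> t \<and> enat k = min (d (fst e)) (d (snd e)) then 1 else 0)"
    using cross by (intro sum_mono) auto
  also have "\<dots> = (\<Sum>e\<in>parcs N. \<Sum>k\<in>{1..D}.
      if fst e \<noteq> s \<and> snd e \<noteq> t \<and> enat k = min (d (fst e)) (d (snd e)) then 1 else 0)"
    by (rule sum.swap)
  also have "\<dots> \<le> (\<Sum>e\<in>parcs N. if fst e \<noteq> s \<and> snd e \<noteq> t then 1 else 0)"
  proof (rule sum_mono)
    fix e
    have "card {k \<in> {1..D}. enat k = m} \<le> 1" for m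
      by (rule card_le_Suc0_iff_eq[THEN iffD2, unfolded One_nat_def[symmetric]]) auto
    then have "real (card {k \<in> {1..D}. enat k = m}) \<le> 1" for m
      by (simp add: of_nat_le_iff[of _ 1, simplified])
    then show "(\<Sum>k\<in>{1..D}. if fst e \<noteq> s \<and> snd e \<noteq> t \<and> enat k = min (d (fst e)) (d (snd e)) then 1 else 0)
        \<le> (if fst e \<noteq> s \<and> snd e \<noteq> t then 1 else (0::real))"
      by (auto simp: sum.inter_filter[symmetric])
  qed
  also have "\<dots> = real (card {e \<in> parcs N. fst e \<noteq> s \<and> snd e \<noteq> t})"
    using pair_finite_arcs by (simp add: sum.inter_filter[symmetric])
  finally show ?thesis .
qed

end


section \<open>Invariants of the shortest augmenting path algorithm\<close>

context flow_network
begin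

text \<open>The walk predicate only depends on the tail and head maps of the residual graph, which are the
  same for every flow; the zero flow is a dummy.\<close>

abbreviation chain :: "'v \<Rightarrow> 'v res_arc list \<Rightarrow> 'v \<Rightarrow> bool" where
  "chain \<equiv> pre_digraph.cas (residual N cap (\<lambda>_. 0))"

lemma chain_simps [simp]:
  "chain v [] w \<longleftrightarrow> v = w"
  "chain v (a # p) w \<longleftrightarrow> res_tail a = v \<and> chain (res_head a) p w"
  by (simp_all add: pre_digraph.cas.simps)

lemma chain_append: "chain v (p @ q) w \<longleftrightarrow> (\<exists>z. chain v p z \<and> chain z q w)"
  by (induction p arbitrary: v) auto

lemma chain_cur_node: "chain s p v \<Longrightarrow> cur_node s p = v"
  by (cases p rule: rev_cases) (auto simp: cur_node_def chain_append)

section \<open>Admissible paths and augmentation\<close>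

lemma admissible_label_less:
  assumes "admissible N cap D' x d a"
  shows "d (res_head a) < d (res_tail a)"
  using assms by (cases "d (res_head a)") (auto simp: admissible_def one_enat_def)

lemma chain_label_le:
  assumes "chain v p w" "\<And>a. a \<in> set p \<Longrightarrow> admissible N cap D' x d a"
  shows "d w \<le> d v"
  using assms
proof (induction p arbitrary: v)
  case (Cons a p)
  then have "d w \<le> d (res_head a)"
    by simp
  also have "\<dots> < d (res_tail a)"
    using admissible_label_less[OF Cons.prems(2)[of a]] by simp
  finally have "d w \<le> d (res_tail a)"
    by simp
  with Cons.prems(1) show ?case
    by simp
qed simp

text \<open>Serves the relabelling step, where it shows that the earlier arcs of the path avoid the
  relabelled node.\<close>

lemma chain_labels:
  assumes "chain v p w" "\<And>a. a \<in> set p \<Longrightarrow> admissible N cap D' x d a" "a \<in> set p"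
  shows "d w \<le> d (res_head a)" "d w < d (res_tail a)"
proof -
  obtain q r where p: "p = q @ a # r"
    using assms(3) by (auto simp: in_set_conv_decomp)
  show "d w \<le> d (res_head a)"
    using assms(1,2) unfolding p by (intro chain_label_le[of _ r]) (auto simp: chain_append)
  with admissible_label_less[OF assms(2)[OF assms(3)]] show "d w < d (res_tail a)"
    by simp
qed

lemma chain_distinct:
  assumes "chain v p w" "\<And>a. a \<in> set p \<Longrightarrow> admissible N cap D' x d a"
  shows "distinct p"
  using assms
proof (induction p arbitrary: v)
  case (Cons a p)
  have "a \<notin> set p"
  proof
    assume "a \<in> set p"
    then obtain q r where p: "p = q @ a # r"
      by (auto simp: in_set_conv_decomp)
    have "d (res_tail a) \<le> d (res_head a)"
      using Cons.prems unfolding p by (intro chain_label_le[of _ q]) (auto simp: chain_append)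
    then show False
      using admissible_label_less[OF Cons.prems(2)[of a]] by simp
  qed
  with Cons show ?case
    by auto
qed simp

text \<open>The changes telescope along the walk. Distinctness matters because membership in the
  path counts a repeated arc only once.\<close>

lemma net_out_augment:
  assumes "chain v p w" "distinct p" "fst ` set p \<subseteq> parcs N"
  shows "net_out N (\<lambda>e. x e + (if (e, True) \<in> set p then \<theta> else 0)
             - (if (e, False) \<in> set p then \<theta> else 0)) i
           = net_out N x i + \<theta> * (of_bool (i = v) - of_bool (i = w))"
  using assms
proof (induction p arbitrary: v)
  case Nil
  then show ?case
    by simp
next
  case (Cons a p)
  let ?f = "\<lambda>p e. x e + (if (e, True) \<in> set p then \<theta> else 0)
             - (if (e, False) \<in> set p then \<theta> else 0)"
  let ?g = "\<lambda>e. if e = fst a then (if snd a then \<theta> else - \<theta>) else 0"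
  have split: "?f (a # p) e = ?f p e + ?g e" for e
    using Cons.prems(2) by (cases a) auto
  have "net_out N (?f (a # p)) i = net_out N (?f p) i + (\<Sum>e\<in>parcs N. ?g e * incidence {i} e)"
    unfolding split net_out_incidence[OF pair_finite_arcs] by (simp only: distrib_right sum.distrib)
  also have "(\<Sum>e\<in>parcs N. ?g e * incidence {i} e)
      = (\<Sum>e\<in>parcs N. if e = fst a then (if snd a then \<theta> else - \<theta>) * incidence {i} (fst a) else 0)"
    by (intro sum.cong) auto
  also have "\<dots> = (if snd a then \<theta> else - \<theta>) * incidence {i} (fst a)"
    using Cons.prems(3) pair_finite_arcs by simp
  also have "\<dots> = \<theta> * (of_bool (i = v) - of_bool (i = res_head a))"
    using Cons.prems(1) by (cases a; cases "snd a") (auto simp: incidence_def)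
  also have "net_out N (?f p) i = net_out N x i + \<theta> * (of_bool (i = res_head a) - of_bool (i = w))"
    using Cons.prems by (intro Cons.IH) auto
  finally show ?case
    by (simp add: algebra_simps)
qed

lemma augment_st_flow:
  assumes "st_flow N cap s t x" "chain s p t"
    and adm: "\<And>a. a \<in> set p \<Longrightarrow> admissible N cap D' x d a"
  shows "st_flow N cap s t (augment cap p x)"
proof -
  define \<theta> where "\<theta> = Min (res_cap cap x ` set p)"
  have aug: "augment cap p x = (\<lambda>e. x e + (if (e, True) \<in> set p then \<theta> else 0)
             - (if (e, False) \<in> set p then \<theta> else 0))"
    unfolding augment_def \<theta>_def Let_def by (rule refl)
  \<comment> \<open>This keeps \<open>Min\<close> from being taken over the empty set.\<close>
  have ne: "p \<noteq> []"
    using assms(2) source_neq_sink by auto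
  have arcs: "fst a \<in> parcs N \<and> res_cap cap x a > 0" if "a \<in> set p" for a
    using adm[OF that] by (simp add: admissible_def arcs_residual)
  then have sub: "fst ` set p \<subseteq> parcs N"
    by blast
  have pos: "\<theta> > 0"
    unfolding \<theta>_def using ne arcs by (subst Min_gr_iff) auto
  have le: "\<theta> \<le> res_cap cap x a" if "a \<in> set p" for a
    unfolding \<theta>_def using that by (intro Min_le) auto
  have "0 \<le> augment cap p x e \<and> augment cap p x e \<le> of_int (cap e)" if "e \<in> parcs N" for e
    using assms(1) that pos le[of "(e, True)"] le[of "(e, False)"]
    by (auto simp: aug st_flow_def)
  moreover have "net_out N (augment cap p x) i = 0" if "i \<in> pverts N - {s, t}" for i
    using assms(1) that net_out_augment[OF assms(2) chain_distinct[OF assms(2) adm] sub, of x \<theta> i]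
    by (auto simp: aug st_flow_def)
  ultimately show ?thesis
    by (simp add: st_flow_def)
qed

text \<open>Only reversals of path arcs can become new residual arcs. Admissible arcs join
  consecutive labels, so the inequality holds in both directions.\<close>

lemma augment_valid_labels:
  assumes "valid_labels N cap t x d"
    and adm: "\<And>a. a \<in> set p \<Longrightarrow> admissible N cap D' x d a"
  shows "valid_labels N cap t (augment cap p x) d"
proof -
  define \<theta> where "\<theta> = Min (res_cap cap x ` set p)"
  have aug: "augment cap p x = (\<lambda>e. x e + (if (e, True) \<in> set p then \<theta> else 0)
             - (if (e, False) \<in> set p then \<theta> else 0))"
    unfolding augment_def \<theta>_def Let_def by (rule refl)
  have pos: "\<theta> > 0" if "p \<noteq> []"
    unfolding \<theta>_def using that adm
    by (subst Min_gr_iff) (auto simp: admissible_def arcs_residual)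
  have rev: "d (fst e) \<le> d (snd e) + 1 \<and> d (snd e) \<le> d (fst e) + 1"
    if "(e, f) \<in> set p" for e f
    using adm[OF that] by (cases f; cases "d (fst e)"; cases "d (snd e)")
      (auto simp: admissible_def one_enat_def)
  have "d (res_tail a) \<le> d (res_head a) + 1" if a: "a \<in> arcs (residual N cap (augment cap p x))" for a
  proof (cases "\<exists>f. (fst a, f) \<in> set p")
    case True
    then show ?thesis
      using rev by (cases a) auto
  next
    case False
    then have "augment cap p x (fst a) = x (fst a)"
      by (auto simp: aug)
    then have "a \<in> arcs (residual N cap x)"
      using a by (cases a) (auto simp: arcs_residual)
    then show ?thesis
      using assms(1) by (simp add: valid_labels_def)
  qed
  then show ?thesis
    using assms(1) by (simp add: valid_labels_def)
qed

text \<open>\<open>st_flow\<close> says nothing about \<open>x\<close> off \<open>parcs N\<close>;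
  the vanishing there later shows that arcs of \<open>G\<close> omitted from a subgraph carry no
  flow.\<close>

definition sap_invariant :: "nat \<Rightarrow> 'v sap_state \<Rightarrow> bool" where
  "sap_invariant D' = (\<lambda>(x, d, p).
     st_flow N cap s t x \<and> (\<forall>e. e \<notin> parcs N \<longrightarrow> x e = 0) \<and> valid_labels N cap t x d \<and>
     (\<exists>v. chain s p v) \<and> (\<forall>a\<in>set p. admissible N cap D' x d a))"

lemma sap_invariant_init: "sap_invariant D' (sap_init N cap t)"
  using valid_labels_init cap_nonneg
  by (simp add: sap_invariant_def sap_init_def st_flow_def net_out_def) (rule exI[of _ s], simp)

text \<open>Arcs leaving \<open>i\<close> are valid by the choice of \<open>m\<close>, the others
  because no label decreases.\<close>

lemma sap_invariant_relabel:
  assumes inv: "sap_invariant D' (x, d, p)" and i: "cur_node s p = i" "i \<noteq> t"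
    and m: "m = (INF a\<in>{a \<in> arcs (residual N cap x). res_tail a = i}. d (res_head a) + 1)"
  shows "sap_invariant D' (x, d(i := m), butlast p)"
proof -
  have valid: "d t = 0" "d (res_tail a) \<le> d (res_head a) + 1"
    if "a \<in> arcs (residual N cap x)" for a
    using inv that by (auto simp: sap_invariant_def valid_labels_def)
  have mono: "d j \<le> (d(i := m)) j" for j
    unfolding m by (auto intro!: INF_greatest dest: valid(2))
  have "(d(i := m)) (res_tail a) \<le> (d(i := m)) (res_head a) + 1"
    if a: "a \<in> arcs (residual N cap x)" for a
  proof -
    have "(d(i := m)) (res_tail a) \<le> d (res_head a) + 1"
      using a valid(2)[OF a] by (auto simp: m intro!: INF_lower)
    also have "\<dots> \<le> (d(i := m)) (res_head a) + 1"
      using mono by (intro add_mono) auto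
    finally show ?thesis .
  qed
  then have "valid_labels N cap t x (d(i := m))"
    using inv i(2) by (simp add: sap_invariant_def valid_labels_def)
  moreover have "(\<exists>v. chain s (butlast p) v) \<and>
      (\<forall>a\<in>set (butlast p). admissible N cap D' x (d(i := m)) a)"
  proof (cases p rule: rev_cases)
    case (snoc q a)
    have q: "chain s q (res_tail a)" "res_head a = i"
      using inv i(1) snoc by (auto simp: sap_invariant_def chain_append cur_node_def)
    have adm: "admissible N cap D' x d a'" if "a' \<in> set p" for a'
      using inv that by (simp add: sap_invariant_def)
    \<comment> \<open>All ends of the arcs in \<open>q\<close> have labels at least that of the tail
      of \<open>a\<close>, so none of them is \<open>i\<close> and their labels are
      unchanged.\<close>
    have "d i < d (res_tail a)"
      using adm[of a] snoc q(2) by (cases "d i") (auto simp: admissible_def one_enat_def)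
    then have "res_tail a' \<noteq> i \<and> res_head a' \<noteq> i" if "a' \<in> set q" for a'
      using chain_labels[OF q(1), of D' x d a'] adm that snoc by fastforce
    then have "admissible N cap D' x (d(i := m)) a'" if "a' \<in> set q" for a'
      using adm[of a'] that snoc by (simp add: admissible_def) metis
    then show ?thesis
      using q(1) snoc by auto
  qed simp
  ultimately show ?thesis
    using inv by (simp add: sap_invariant_def)
qed

lemma sap_invariant_step:
  assumes "sap_step N cap s t D' \<sigma> \<tau>" "sap_invariant D' \<sigma>"
  shows "sap_invariant D' \<tau>"
  using assms
proof cases
  case (advance d p x a)
  then show ?thesis
    using assms(2) chain_cur_node by (fastforce simp: sap_invariant_def chain_append)
next
  case (augment d p x)
  have inv: "st_flow N cap s t x" "valid_labels N cap t x d" "\<And>e. e \<notin> parcs N \<Longrightarrow> x e = 0"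
    "\<And>a. a \<in> set p \<Longrightarrow> admissible N cap D' x d a" "chain s p t"
    using assms(2) augment chain_cur_node by (auto simp: sap_invariant_def)
  have "(e, f) \<notin> set p" if "e \<notin> parcs N" for e f
    using inv(4)[of "(e, f)"] that by (auto simp: admissible_def arcs_residual)
  then have "augment cap p x e = 0" if "e \<notin> parcs N" for e
    using inv(3) that by (simp add: augment_def Let_def)
  then show ?thesis
    using augment augment_st_flow[OF inv(1,5,4)] augment_valid_labels[OF inv(2,4)]
    by (auto simp: sap_invariant_def)
next
  case (relabel d p i x)
  then show ?thesis
    using assms(2) sap_invariant_relabel by blast
qed

section \<open>Properties of the returned flow\<close>

lemma sap_output_invariant:
  assumes "sap_output N cap s t D' x"
  obtains d where "st_flow N cap s t x" "\<And>e. e \<notin> parcs N \<Longrightarrow> x e = 0"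
    "valid_labels N cap t x d" "sap_stopped N s D' d"
proof -
  obtain d p where dp: "(sap_step N cap s t D')\<^sup>*\<^sup>* (sap_init N cap t) (x, d, p)"
    "sap_stopped N s D' d"
    using assms by (auto simp: sap_output_def)
  from dp(1) have "sap_invariant D' (x, d, p)"
    by (induction rule: rtranclp_induct) (auto intro: sap_invariant_init sap_invariant_step)
  then show ?thesis
    using dp(2) that by (auto simp: sap_invariant_def)
qed

text \<open>Stopping at \<open>D + 2\<close> is covered by the level cuts; stopping at the number of
  nodes makes \<open>x\<close> maximum, so the left side is nonpositive.\<close>

lemma sap_output_gap:
  assumes "sap_output N cap s t (D + 2) x" "st_flow N cap s t y"
    and "\<And>e. e \<in> parcs N \<Longrightarrow> fst e \<noteq> s \<Longrightarrow> snd e \<noteq> t \<Longrightarrow> cap e \<le> 1"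
  shows "real D * (flow_value N s y - flow_value N s x)
           \<le> real (card {e \<in> parcs N. fst e \<noteq> s \<and> snd e \<noteq> t})"
proof -
  obtain d where d: "st_flow N cap s t x" "valid_labels N cap t x d" "sap_stopped N s (D + 2) d"
    using sap_output_invariant[OF assms(1)] by metis
  show ?thesis
  proof (cases "enat (D + 2) \<le> d s")
    case True
    then show ?thesis
      using source_label_gap d assms by blast
  next
    case False
    then have "flow_value N s y - flow_value N s x \<le> 0"
      using source_label_card_imp_max_flow d assms(2) by (auto simp: sap_stopped_def)
    then have "real D * (flow_value N s y - flow_value N s x) \<le> 0"
      by (simp add: mult_nonneg_nonpos)
    then show ?thesis
      by linarith
  qed
qed

text \<open>If no residual arc leaves the source, its initial label is \<open>\<infinity>\<close>.\<close>

lemma sap_output_isolated_source: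
  assumes "sap_output N cap s t D' x" "\<And>e. e \<in> parcs N \<Longrightarrow> fst e \<noteq> s \<and> snd e \<noteq> s"
  shows "x = (\<lambda>_. 0)"
proof -
  obtain d p where dp: "(sap_step N cap s t D')\<^sup>*\<^sup>* (sap_init N cap t) (x, d, p)"
    using assms by (auto simp: sap_output_def)
  interpret R: wf_digraph "residual N cap (\<lambda>_. 0)"
    by (rule wf_digraph_residual)
  have "\<not> R.apath s p t" for p
  proof (cases p)
    case (Cons a q)
    then show ?thesis
      using assms(2) by (cases a; cases "snd a") (auto simp: R.apath_Cons_iff arcs_residual)
  qed (use source_neq_sink in \<open>simp add: R.apath_Nil_iff\<close>)
  then have "arc_dist (residual N cap (\<lambda>_. 0)) s t = \<infinity>"
    by (simp add: arc_dist_def top_enat_def)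
  \<comment> \<open>The label \<infinity> meets the stopping test already, so no rule
    applies.\<close>
  then have "\<not> sap_step N cap s t D' (sap_init N cap t) \<tau>" for \<tau>
    by (auto simp: sap_init_def sap_stopped_def elim!: sap_step.cases)
  then have "(x, d, p) = sap_init N cap t"
    using dp by (metis converse_rtranclpE)
  then show ?thesis
    by (simp add: sap_init_def)
qed

end


section \<open>Bisection\<close>

text \<open>No monotonicity of \<open>P\<close> is needed here: the invariant is that \<open>P\<close> has been
  observed at the upper end and its failure just below the lower end.\<close>

lemma bisect_bounds:
  assumes "l \<le> u"
  shows "bisect P l u \<in> {l..u} \<and> (bisect P l u = u \<or> P (bisect P l u)) \<and>
         (bisect P l u = l \<or> \<not> P (bisect P l u - 1))"
  using assms
proof (induction P l u rule: bisect.induct)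
  case (1 P l u)
  show ?case
  proof (cases "l < u")
    case True
    define k where "k = (l + u) div 2"
    have k: "l \<le> k" "k < u"
      using True by (auto simp: k_def)
    show ?thesis
    proof (cases "P k")
      case True
      have "bisect P l u = bisect P l k"
        using \<open>l < u\<close> True by (subst bisect.simps) (simp add: k_def Let_def)
      moreover note 1(1)[OF \<open>l < u\<close> k_def True k(1)]
      ultimately show ?thesis
        using k True by auto
    next
      case False
      have "bisect P l u = bisect P (k + 1) u"
        using \<open>l < u\<close> False by (subst bisect.simps) (simp add: k_def Let_def)
      moreover have "k + 1 \<le> u"
        using k by simp
      moreover note 1(2)[OF \<open>l < u\<close> k_def False this]
      ultimately show ?thesis
        \<comment> \<open>If the result is the new lower end \<open>k + 1\<close>, the failure just
          below it is the test at \<open>k\<close> itself.\<close>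
        using k False by (cases "bisect P (k + 1) u = k + 1") auto
    qed
  next
    case False
    then show ?thesis
      using 1(3) by (subst (1 2 3 4 5) bisect.simps) simp
  qed
qed


section \<open>The auxiliary network\<close>

lemma parcs_aux_subgraph_cases:
  assumes "e \<in> parcs (aux_subgraph G c b \<alpha>)"
  obtains (orig) i j where "e = (Orig i, Orig j)" "(i, j) \<in> parcs G" "of_int (c (i, j)) \<le> \<alpha>"
    | (src) i where "e = (Src, Orig i)" "i \<in> supply_nodes G b"
    | (snk) j where "e = (Orig j, Snk)" "j \<in> demand_nodes G b"
  using assms by (auto simp: aux_subgraph_def terminal_arcs_def)

text \<open>No arc enters \<open>Src\<close>, and its outgoing arcs belong to every subgraph, so the
  value is the same in all of them.\<close>

lemma flow_value_aux_subgraph: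
  "flow_value (aux_subgraph G c b \<alpha>) Src x = (\<Sum>i\<in>supply_nodes G b. x (Src, Orig i))"
  "flow_value (aux_graph G b) Src x = (\<Sum>i\<in>supply_nodes G b. x (Src, Orig i))"
proof -
  have "{j. (Src, j) \<in> parcs (aux_subgraph G c b \<alpha>)} = Orig ` supply_nodes G b"
    "{j. (Src, j) \<in> parcs (aux_graph G b)} = Orig ` supply_nodes G b"
    "{j. (j, Src) \<in> parcs (aux_subgraph G c b \<alpha>)} = {}"
    "{j. (j, Src) \<in> parcs (aux_graph G b)} = {}"
    by (auto simp: aux_subgraph_def aux_graph_def terminal_arcs_def)
  then show "flow_value (aux_subgraph G c b \<alpha>) Src x = (\<Sum>i\<in>supply_nodes G b. x (Src, Orig i))"
    "flow_value (aux_graph G b) Src x = (\<Sum>i\<in>supply_nodes G b. x (Src, Orig i))"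
    by (simp_all add: flow_value_def net_out_def sum.reindex inj_on_def)
qed

locale unit_bnfp = bnfp_instance G b for G :: "'a pair_pre_digraph" and b +
  fixes c u :: "'a \<times> 'a \<Rightarrow> int"
  assumes unit_capacity: "e \<in> parcs G \<Longrightarrow> u e = 1"
begin

abbreviation arcs_upto :: "real \<Rightarrow> ('a \<times> 'a) set" where
  "arcs_upto \<alpha> \<equiv> {e \<in> parcs G. of_int (c e) \<le> \<alpha>}"

lemma finite_nodes: "finite (supply_nodes G b)" "finite (demand_nodes G b)"
  using pair_finite_verts by (simp_all add: supply_nodes_def demand_nodes_def)

lemma parcs_aux_subgraph:
  "parcs (aux_subgraph G c b \<alpha>) = (\<lambda>(i, j). (Orig i, Orig j)) ` arcs_upto \<alpha> \<union> terminal_arcs G b"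
  by (auto simp: aux_subgraph_def)

lemma flow_network_aux_subgraph:
  "flow_network (aux_subgraph G c b \<alpha>) (aux_cap u b) Src Snk"
proof
  show "finite (parcs (aux_subgraph G c b \<alpha>))"
    using pair_finite_arcs finite_nodes by (simp add: parcs_aux_subgraph terminal_arcs_def)
  fix e
  assume "e \<in> parcs (aux_subgraph G c b \<alpha>)"
  then show "fst e \<in> pverts (aux_subgraph G c b \<alpha>)" "snd e \<in> pverts (aux_subgraph G c b \<alpha>)"
    "0 \<le> aux_cap u b e"
    by (cases rule: parcs_aux_subgraph_cases;
        auto simp: aux_subgraph_def aux_graph_def supply_nodes_def demand_nodes_def unit_capacity
          dest: in_arcsD1 in_arcsD2)+
qed (use pair_finite_verts in \<open>simp_all add: aux_subgraph_def aux_graph_def\<close>)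

lemma card_inner_arcs:
  "card {e \<in> parcs (aux_subgraph G c b \<alpha>). fst e \<noteq> Src \<and> snd e \<noteq> Snk} = card (arcs_upto \<alpha>)"
proof -
  have "{e \<in> parcs (aux_subgraph G c b \<alpha>). fst e \<noteq> Src \<and> snd e \<noteq> Snk}
      = (\<lambda>(i, j). (Orig i, Orig j)) ` arcs_upto \<alpha>"
    by (auto simp: parcs_aux_subgraph terminal_arcs_def)
  then show ?thesis
    by (simp add: card_image inj_on_def)
qed

lemma card_parcs_aux_subgraph:
  "card (arcs_upto \<alpha>) \<le> card (parcs (aux_subgraph G c b \<alpha>))"
  "card (parcs (aux_subgraph G c b \<alpha>))
     \<le> card (arcs_upto \<alpha>) + (card (supply_nodes G b) + card (demand_nodes G b))"
proof -
  interpret H: flow_network "aux_subgraph G c b \<alpha>" "aux_cap u b" Src Snk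
    by (rule flow_network_aux_subgraph)
  show "card (arcs_upto \<alpha>) \<le> card (parcs (aux_subgraph G c b \<alpha>))"
    unfolding card_inner_arcs[symmetric] using H.pair_finite_arcs by (intro card_mono) auto
  have "card (terminal_arcs G b) \<le> card (supply_nodes G b) + card (demand_nodes G b)"
    unfolding terminal_arcs_def using finite_nodes
    by (intro order_trans[OF card_Un_le] add_mono card_image_le)
  moreover have "card ((\<lambda>(i, j). (Orig i, Orig j)) ` arcs_upto \<alpha>) \<le> card (arcs_upto \<alpha>)"
    using pair_finite_arcs by (intro card_image_le) simp
  ultimately show "card (parcs (aux_subgraph G c b \<alpha>))
     \<le> card (arcs_upto \<alpha>) + (card (supply_nodes G b) + card (demand_nodes G b))"
    unfolding parcs_aux_subgraph by (intro order_trans[OF card_Un_le]) simp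
qed

text \<open>Terminal arcs may have capacity above 1, but they contribute nothing to the level cuts,
  so only original arcs are counted.\<close>

lemma sap_output_aux_gap:
  assumes "sap_output (aux_subgraph G c b \<alpha>) (aux_cap u b) Src Snk (D + 2) x"
    and "st_flow (aux_subgraph G c b \<alpha>) (aux_cap u b) Src Snk y" "D > 0"
  shows "flow_value (aux_subgraph G c b \<alpha>) Src y - flow_value (aux_subgraph G c b \<alpha>) Src x
           \<le> real (card (arcs_upto \<alpha>)) / real D"
proof -
  interpret H: flow_network "aux_subgraph G c b \<alpha>" "aux_cap u b" Src Snk
    by (rule flow_network_aux_subgraph)
  have "aux_cap u b e \<le> 1"
    if "e \<in> parcs (aux_subgraph G c b \<alpha>)" "fst e \<noteq> Src" "snd e \<noteq> Snk" for e
    using that by (cases rule: parcs_aux_subgraph_cases) (auto simp: unit_capacity)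
  from H.sap_output_gap[OF assms(1,2) this] show ?thesis
    using assms(3) by (simp add: card_inner_arcs field_simps)
qed

text \<open>Saturates every terminal arc, which turns the balance equations into flow
  conservation.\<close>

definition aux_flow :: "('a \<times> 'a \<Rightarrow> real) \<Rightarrow> 'a aux_vertex \<times> 'a aux_vertex \<Rightarrow> real" where
  "aux_flow y e = (case e of (Orig i, Orig j) \<Rightarrow> y (i, j) | _ \<Rightarrow> of_int (aux_cap u b e))"

lemma aux_flow_simps [simp]:
  "aux_flow y (Orig i, Orig j) = y (i, j)"
  "aux_flow y (Src, Orig i) = of_int (b i)"
  "aux_flow y (Orig i, Snk) = - of_int (b i)"
  by (simp_all add: aux_flow_def)

text \<open>At a node of \<open>G\<close> the saturated terminal arc cancels the imbalance
  \<open>b i\<close>. The omitted arcs carry no flow, so no sum changes.\<close>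

lemma st_flow_aux_flow:
  assumes "bnfp_feasible G u b y"
    and supp: "\<And>e. e \<in> parcs G \<Longrightarrow> y e > 0 \<Longrightarrow> of_int (c e) \<le> \<alpha>"
  shows "st_flow (aux_subgraph G c b \<alpha>) (aux_cap u b) Src Snk (aux_flow y)"
proof -
  let ?H = "aux_subgraph G c b \<alpha>"
  have y: "0 \<le> y e" "y e \<le> of_int (u e)" if "e \<in> parcs G" for e
    using assms(1) that by (auto simp: bnfp_feasible_def)
  have zero: "y e = 0" if "e \<in> parcs G" "\<not> of_int (c e) \<le> \<alpha>" for e
    using y(1)[of e] supp[of e] that by force
  have "0 \<le> aux_flow y e \<and> aux_flow y e \<le> of_int (aux_cap u b e)" if "e \<in> parcs ?H" for e
    using that by (cases rule: parcs_aux_subgraph_cases)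
      (auto simp: y supply_nodes_def demand_nodes_def)
  moreover have "net_out ?H (aux_flow y) v = 0" if v: "v \<in> pverts ?H - {Src, Snk}" for v
  proof -
    obtain i where i: "v = Orig i" "i \<in> pverts G"
      using v by (auto simp: aux_subgraph_def aux_graph_def)
    have fin: "finite {j. (i, j) \<in> parcs G}" "finite {j. (j, i) \<in> parcs G}"
      using pair_finite_verts by (auto intro: finite_subset[of _ "pverts G"] dest: in_arcsD1 in_arcsD2)
    have out: "(\<Sum>j\<in>{j. (Orig i, j) \<in> parcs ?H}. aux_flow y (Orig i, j))
        = (\<Sum>j\<in>{j. (i, j) \<in> parcs G}. y (i, j)) + of_int (if b i < 0 then - b i else 0)"
    proof -
      have arcs: "{j. (Orig i, j) \<in> parcs ?H}
          = Orig ` {j. (i, j) \<in> arcs_upto \<alpha>} \<union> (if b i < 0 then {Snk} else {})"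
        using i by (auto simp: aux_subgraph_def terminal_arcs_def demand_nodes_def)
      have "finite {j. (i, j) \<in> arcs_upto \<alpha>}"
        by (rule finite_subset[OF _ fin(1)]) auto
      moreover have "(\<Sum>j\<in>{j. (i, j) \<in> arcs_upto \<alpha>}. y (i, j)) = (\<Sum>j\<in>{j. (i, j) \<in> parcs G}. y (i, j))"
        using fin(1) zero by (intro sum.mono_neutral_left) auto
      ultimately show ?thesis
        unfolding arcs by (subst sum.union_disjoint) (auto simp: sum.reindex inj_on_def)
    qed
    have inn: "(\<Sum>j\<in>{j. (j, Orig i) \<in> parcs ?H}. aux_flow y (j, Orig i))
        = (\<Sum>j\<in>{j. (j, i) \<in> parcs G}. y (j, i)) + of_int (if b i > 0 then b i else 0)"
    proof -
      have arcs: "{j. (j, Orig i) \<in> parcs ?H}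
          = Orig ` {j. (j, i) \<in> arcs_upto \<alpha>} \<union> (if b i > 0 then {Src} else {})"
        using i by (auto simp: aux_subgraph_def terminal_arcs_def supply_nodes_def)
      have "finite {j. (j, i) \<in> arcs_upto \<alpha>}"
        by (rule finite_subset[OF _ fin(2)]) auto
      moreover have "(\<Sum>j\<in>{j. (j, i) \<in> arcs_upto \<alpha>}. y (j, i)) = (\<Sum>j\<in>{j. (j, i) \<in> parcs G}. y (j, i))"
        using fin(2) zero by (intro sum.mono_neutral_left) auto
      ultimately show ?thesis
        unfolding arcs by (subst sum.union_disjoint) (auto simp: sum.reindex inj_on_def)
    qed
    have "net_out G y i = of_int (b i)"
      using assms(1) i(2) by (simp add: bnfp_feasible_def)
    then show ?thesis
      unfolding i(1) net_out_def out inn by (auto simp: not_less)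
  qed
  ultimately show ?thesis
    by (simp add: st_flow_def)
qed

lemma flow_value_aux_flow:
  "flow_value (aux_subgraph G c b \<alpha>) Src (aux_flow y) = of_int (total_supply G b)"
  by (simp add: flow_value_aux_subgraph total_supply_def)

end


section \<open>The bounds\<close>

context unit_bnfp
begin

lemma no_flow_imp_zero_balance:
  assumes "bnfp_feasible G u b y" "\<And>e. e \<in> parcs G \<Longrightarrow> \<not> y e > 0" "i \<in> pverts G"
  shows "b i = 0"
proof -
  have "y e = 0" if "e \<in> parcs G" for e
    using assms(1) assms(2)[OF that] that by (force simp: bnfp_feasible_def)
  then have "net_out G y i = 0"
    by (simp add: net_out_def)
  then show ?thesis
    using assms(1,3) by (simp add: bnfp_feasible_def)
qed

section \<open>The sorted arc weights\<close>

lemma nth_weight_mono: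
  assumes "i \<le> j" "1 \<le> j" "j \<le> card (c ` parcs G)"
  shows "nth_weight G c i \<le> nth_weight G c j"
  unfolding nth_weight_def using assms by (intro sorted_nth_mono) auto

lemma weight_eq_nth_weight:
  assumes "e \<in> parcs G"
  obtains n where "1 \<le> n" "n \<le> card (c ` parcs G)" "c e = nth_weight G c n"
proof -
  let ?l = "sorted_list_of_set (c ` parcs G)"
  have "c e \<in> set ?l"
    using assms(1) pair_finite_arcs by simp
  then obtain n where "n < length ?l" "?l ! n = c e"
    unfolding in_set_conv_nth by blast
  then show ?thesis
    using that[of "Suc n"] by (simp add: nth_weight_def Suc_le_eq)
qed

text \<open>No weight lies strictly between consecutive entries of the sorted list.\<close>

lemma nth_weight_least:
  assumes "e \<in> parcs G" "k \<le> card (c ` parcs G)" "nth_weight G c (k - 1) < c e"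
  shows "nth_weight G c k \<le> c e"
proof -
  obtain n where n: "1 \<le> n" "n \<le> card (c ` parcs G)" "c e = nth_weight G c n"
    using weight_eq_nth_weight[OF assms(1)] .
  have "k - 1 \<le> card (c ` parcs G)"
    using assms(2) by linarith
  then have "\<not> n \<le> k - 1"
    using n assms(3) nth_weight_mono[of n "k - 1"] by auto
  then show ?thesis
    using n nth_weight_mono[of k n] by simp
qed

lemma nth_weight_1_le:
  assumes "e \<in> parcs G"
  shows "nth_weight G c 1 \<le> c e"
  using weight_eq_nth_weight[OF assms] nth_weight_mono by metis

lemma le_nth_weight_card:
  assumes "e \<in> parcs G"
  shows "c e \<le> nth_weight G c (card (c ` parcs G))"
  using weight_eq_nth_weight[OF assms] nth_weight_mono by (metis order_trans order_refl)

end

section \<open>A run of the algorithm\<close>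

locale abst_run = unit_bnfp G b c u for G :: "'a pair_pre_digraph" and b c u +
  fixes D :: nat and X :: "real \<Rightarrow> 'a aux_vertex \<times> 'a aux_vertex \<Rightarrow> real"
  assumes D_pos: "D > 0"
    and X: "sap_output (aux_subgraph G c b \<alpha>) (aux_cap u b) Src Snk (D + 2) (X \<alpha>)"
    and max_flow: "\<exists>x. st_flow (aux_graph G b) (aux_cap u b) Src Snk x \<and>
             flow_value (aux_graph G b) Src x = of_int (total_supply G b)"
begin

definition final :: nat where
  "final = bisect (abst_test G c b D X) 1 (card (c ` parcs G))"

abbreviation \<alpha> :: real where
  "\<alpha> \<equiv> of_int (nth_weight G c final)"

text \<open>Used contrapositively: after a failed test at \<beta>, every feasible solution uses an
  arc heavier than \<beta>.\<close>

lemma gap_of_feasible: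
  assumes "bnfp_feasible G u b y" "\<And>e. e \<in> parcs G \<Longrightarrow> y e > 0 \<Longrightarrow> of_int (c e) \<le> \<beta>"
  shows "of_int (total_supply G b) - flow_value (aux_subgraph G c b \<beta>) Src (X \<beta>)
           \<le> real (card (parcs (aux_subgraph G c b \<beta>))) / real D"
proof -
  have "of_int (total_supply G b) - flow_value (aux_subgraph G c b \<beta>) Src (X \<beta>)
      \<le> real (card (arcs_upto \<beta>)) / real D"
    using sap_output_aux_gap[OF X st_flow_aux_flow[OF assms] D_pos]
    by (simp add: flow_value_aux_flow)
  also have "\<dots> \<le> real (card (parcs (aux_subgraph G c b \<beta>))) / real D"
    using card_parcs_aux_subgraph(1) by (intro divide_right_mono) auto
  finally show ?thesis .
qed

text \<open>Here the subgraph is the whole auxiliary graph, so the assumed flow of value \<delta>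
  can be compared. This covers the last index, which the bisection never tests.\<close>

lemma gap_of_all_arcs:
  assumes "\<And>e. e \<in> parcs G \<Longrightarrow> of_int (c e) \<le> \<beta>"
  shows "of_int (total_supply G b) - flow_value (aux_graph G b) Src (X \<beta>)
           \<le> real (card (parcs G)) / real D"
proof -
  have "aux_subgraph G c b \<beta> = aux_graph G b"
    using assms by (auto simp: aux_subgraph_def aux_graph_def)
  moreover have "arcs_upto \<beta> = parcs G"
    using assms by auto
  ultimately show ?thesis
    using max_flow sap_output_aux_gap[OF X _ D_pos, of \<beta>] by metis
qed

lemma final_cases:
  assumes "parcs G \<noteq> {}"
  shows "1 \<le> final" "final \<le> card (c ` parcs G)"
    "final = card (c ` parcs G) \<or> abst_test G c b D X final"
    "final = 1 \<or> \<not> abst_test G c b D X (final - 1)"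
proof -
  have "1 \<le> card (c ` parcs G)"
    using assms pair_finite_arcs by (simp add: Suc_le_eq card_gt_0_iff)
  from bisect_bounds[OF this, of "abst_test G c b D X"]
  show "1 \<le> final" "final \<le> card (c ` parcs G)"
    "final = card (c ` parcs G) \<or> abst_test G c b D X final"
    "final = 1 \<or> \<not> abst_test G c b D X (final - 1)"
    by (auto simp: final_def)
qed

lemma gap_final:
  assumes "card (supply_nodes G b) + card (demand_nodes G b) \<le> card (parcs G) + 1"
  shows "of_int (total_supply G b) - flow_value (aux_graph G b) Src (X \<alpha>)
           \<le> 2 * real (card (parcs G)) / real D"
proof (cases "\<forall>e\<in>parcs G. of_int (c e) \<le> \<alpha>")
  case True
  then have "of_int (total_supply G b) - flow_value (aux_graph G b) Src (X \<alpha>)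
      \<le> real (card (parcs G)) / real D"
    by (intro gap_of_all_arcs) auto
  also have "\<dots> \<le> 2 * real (card (parcs G)) / real D"
    by (intro divide_right_mono) auto
  finally show ?thesis .
next
  case False
  then have "arcs_upto \<alpha> \<subset> parcs G"
    by auto
  then have "card (arcs_upto \<alpha>) < card (parcs G)"
    using pair_finite_arcs by (intro psubset_card_mono) auto
  \<comment> \<open>At most |E| - 1 original arcs and |E| + 1 terminal arcs.\<close>
  then have card: "card (parcs (aux_subgraph G c b \<alpha>)) \<le> 2 * card (parcs G)"
    using card_parcs_aux_subgraph(2)[of \<alpha>] assms by linarith
  \<comment> \<open>An arc heavier than \<alpha> exists, so \<open>final\<close> is not the last
    index and its test was passed.\<close>
  have "abst_test G c b D X final"
    using False final_cases(3) le_nth_weight_card by force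
  then have "of_int (total_supply G b) - flow_value (aux_graph G b) Src (X \<alpha>)
      \<le> real (card (parcs (aux_subgraph G c b \<alpha>))) / real D"
    by (simp add: abst_test_def Let_def flow_value_aux_subgraph)
  also have "\<dots> \<le> 2 * real (card (parcs G)) / real D"
    using card by (intro divide_right_mono) (auto simp: of_nat_le_iff[symmetric])
  finally show ?thesis .
qed

text \<open>A flow of value 0 could still contain circulations; it is the lack of arcs at
  \<open>Src\<close> that ends the run at once with the zero flow.\<close>

lemma X_no_supply:
  assumes "supply_nodes G b = {}"
  shows "X \<beta> = (\<lambda>_. 0)"
proof -
  interpret H: flow_network "aux_subgraph G c b \<beta>" "aux_cap u b" Src Snk
    by (rule flow_network_aux_subgraph)
  have "fst e \<noteq> Src \<and> snd e \<noteq> Src" if "e \<in> parcs (aux_subgraph G c b \<beta>)" for e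
    using that assms by (cases rule: parcs_aux_subgraph_cases) auto
  from H.sap_output_isolated_source[OF X this] show ?thesis .
qed

lemma X_support:
  assumes "e \<in> parcs G" "orig_flow (X \<beta>) e > 0"
  shows "of_int (c e) \<le> \<beta>"
proof (rule ccontr)
  assume *: "\<not> ?thesis"
  interpret H: flow_network "aux_subgraph G c b \<beta>" "aux_cap u b" Src Snk
    by (rule flow_network_aux_subgraph)
  obtain i j where e: "e = (i, j)"
    by (cases e)
  have "(Orig i, Orig j) \<notin> parcs (aux_subgraph G c b \<beta>)"
    using * e by (auto simp: aux_subgraph_def terminal_arcs_def)
  then have "X \<beta> (Orig i, Orig j) = 0"
    using H.sap_output_invariant[OF X[of \<beta>]] by metis
  then show False
    using assms(2) e by (simp add: orig_flow_def)
qed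

text \<open>A feasible \<open>y\<close> with flow uses an arc of weight at least \<alpha>: at index
  1 this is the least weight, otherwise the test just below \<open>final\<close> failed. The output
  uses only weights up to \<alpha>.\<close>

lemma bottleneck_final_le:
  assumes y: "bnfp_feasible G u b y"
  shows "bottleneck G c (orig_flow (X \<alpha>)) \<le> bottleneck G c y"
proof (cases "\<exists>e\<in>parcs G. y e > 0")
  case False
  \<comment> \<open>The objective of \<open>y\<close> is -\<infinity> here, so the output must carry
    no flow on \<open>G\<close> either.\<close>
  then have "supply_nodes G b = {}"
    using no_flow_imp_zero_balance[OF y] by (auto simp: supply_nodes_def)
  then show ?thesis
    by (simp add: X_no_supply bottleneck_def orig_flow_def bot_ereal_def)
next
  case True
  then obtain e\<^sub>0 where e0: "e\<^sub>0 \<in> parcs G" "y e\<^sub>0 > 0"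
    by blast
  then have ne: "parcs G \<noteq> {}"
    by auto
  obtain e where e: "e \<in> parcs G" "y e > 0" "nth_weight G c final \<le> c e"
  proof (cases "final = 1")
    case True
    then show ?thesis
      using that e0 nth_weight_1_le by simp
  next
    case False
    let ?\<beta> = "of_int (nth_weight G c (final - 1)) :: real"
    have "\<not> abst_test G c b D X (final - 1)"
      using final_cases(4)[OF ne] False by simp
    then obtain e where "e \<in> parcs G" "y e > 0" "\<not> of_int (c e) \<le> ?\<beta>"
      using gap_of_feasible[OF y, of ?\<beta>] by (auto simp: abst_test_def Let_def)
    moreover from this have "nth_weight G c final \<le> c e"
      using final_cases(2)[OF ne] by (intro nth_weight_least) auto
    ultimately show ?thesis
      using that by blast
  qed
  have "bottleneck G c (orig_flow (X \<alpha>)) \<le> ereal \<alpha>"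
    unfolding bottleneck_def using X_support[of _ \<alpha>] by (intro SUP_least) (simp del: of_int_le_iff)
  also have "\<dots> \<le> ereal (of_int (c e))"
    using e(3) by simp
  also have "\<dots> \<le> bottleneck G c y"
    unfolding bottleneck_def using e by (intro SUP_upper) auto
  finally show ?thesis .
qed

end

text \<open>The premise on the terminal nodes holds for every weakly connected \<open>G\<close>:
  they are distinct nodes, and |V| is at most |E| + 1.\<close>

theorem theorem4p4:
  fixes G :: "'a pair_pre_digraph"
    and c u :: "'a \<times> 'a \<Rightarrow> int"
    and b :: "'a \<Rightarrow> int"
    and D :: nat
    and xbar :: "'a aux_vertex \<times> 'a aux_vertex \<Rightarrow> real"
  assumes "bnfp_instance G b"
    and unit_capacity: "\<forall>e\<in>parcs G. u e = 1"
    and "\<exists>x. st_flow (aux_graph G b) (aux_cap u b) Src Snk x \<and>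
             flow_value (aux_graph G b) Src x = of_int (total_supply G b)"
    and "D > 0"
    and "abst_output G c u b D xbar"
  shows "bottleneck G c (orig_flow xbar) \<le> bnfp_opt G c u b \<and>
         (card (supply_nodes G b) + card (demand_nodes G b) \<le> card (parcs G) + 1 \<longrightarrow>
          of_int (total_supply G b) - flow_value (aux_graph G b) Src xbar
            \<le> 2 * real (card (parcs G)) / real D)"
proof -
  interpret bnfp_instance G b
    by fact
  obtain X where X: "\<And>\<alpha>. sap_output (aux_subgraph G c b \<alpha>) (aux_cap u b) Src Snk (D + 2) (X \<alpha>)"
    and X_final: "xbar = X (of_int (nth_weight G c (bisect (abst_test G c b D X) 1 (card (c ` parcs G)))))"
    using assms(5) by (auto simp: abst_output_def)
  interpret abst_run G b c u D X
    using assms(2-4) X by unfold_locales auto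
  have xbar: "xbar = X \<alpha>"
    by (simp add: X_final final_def)
  show ?thesis
    unfolding xbar bnfp_opt_def using bottleneck_final_le gap_final by (auto intro: INF_greatest)
qed

end
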